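(* For every $n\ge 3$, the number of permutations $\sigma$ of length $n$ for which $\mathrm{Sort}(\sigma)$ is not a permutation class is equal to the $n$-th Catalan number $\mathfrak{c}_n=\frac{1}{n+1}\binom{2n}{n}$.
   Context: A permutation $\pi$ contains a pattern $\tau$ if some (not necessarily consecutive) subsequence of $\pi$ is order isomorphic to $\tau$. A permutation class is a set of permutations closed downwards under pattern containment. For a permutation $\sigma$ of length at least $2$, the $\sigma$-stack acts on an input permutation $\pi=\pi_1\cdots\pi_n$ as follows (starting with empty stack and output). For $i=1,\dots,n$: as long as pushing $\pi_i$ on top of the stack would make the content of the stack, read from top to bottom, contain an occurrence of $\sigma$, pop the top element and append it to the output; then push $\pi_i$. After all letters have been pushed, pop all remaining elements, from top to bottom, appending them to the output. The resulting output is denoted $\mathcal{S}^{\sigma}(\pi)$. The permutation $\pi$ of length $n$ is $\sigma$-sortable if $\mathcal{S}^{21}(\mathcal{S}^{\sigma}(\pi))=12\cdots n$. $\mathrm{Sort}(\sigma)$ is the set of $\sigma$-sortable permutations. *)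

theory Defs
  imports Complex_Main "HOL-Library.Sublist" "HOL-Combinatorics.Multiset_Permutations"
begin

text \<open>Permutations are written in one-line notation, as lists over \<open>{1..n}\<close>.\<close>

definition perms_of_length :: "nat \<Rightarrow> nat list set" where
  "perms_of_length n = permutations_of_set {1..n}"

definition perms :: "nat list set" where
  "perms = (\<Union>n. perms_of_length n)"

definition order_isomorphic :: "nat list \<Rightarrow> nat list \<Rightarrow> bool" where
  "order_isomorphic xs ys \<longleftrightarrow> length xs = length ys \<and>
     (\<forall>i<length xs. \<forall>j<length xs. xs ! i < xs ! j \<longleftrightarrow> ys ! i < ys ! j)"

text \<open>The first argument is an arbitrary word, since the content of a stack need not be
  a permutation of an initial segment.\<close>

definition contains_pattern :: "nat list \<Rightarrow> nat list \<Rightarrow> bool" where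
  "contains_pattern xs \<tau> \<longleftrightarrow> (\<exists>ys. subseq ys xs \<and> order_isomorphic ys \<tau>)"

definition permutation_class :: "nat list set \<Rightarrow> bool" where
  "permutation_class C \<longleftrightarrow> C \<subseteq> perms \<and>
     (\<forall>\<pi>\<in>C. \<forall>\<tau>\<in>perms. contains_pattern \<pi> \<tau> \<longrightarrow> \<tau> \<in> C)"

text \<open>A state is a pair of stack (top first) and output. A letter can always be pushed on the
  empty stack, because patterns have length at least 2.\<close>

fun pop_for :: "nat list \<Rightarrow> nat \<Rightarrow> nat list \<times> nat list \<Rightarrow> nat list \<times> nat list" where
  "pop_for \<sigma> x ([], out) = ([], out)"
| "pop_for \<sigma> x (s # st, out) =
     (if contains_pattern (x # s # st) \<sigma> then pop_for \<sigma> x (st, out @ [s]) else (s # st, out))"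

definition push_letter :: "nat list \<Rightarrow> nat \<Rightarrow> nat list \<times> nat list \<Rightarrow> nat list \<times> nat list" where
  "push_letter \<sigma> x state = (case pop_for \<sigma> x state of (st, out) \<Rightarrow> (x # st, out))"

definition stack_output :: "nat list \<Rightarrow> nat list \<Rightarrow> nat list" where
  "stack_output \<sigma> \<pi> = (case fold (push_letter \<sigma>) \<pi> ([], []) of (st, out) \<Rightarrow> out @ st)"

definition sortable :: "nat list \<Rightarrow> nat list \<Rightarrow> bool" where
  "sortable \<sigma> \<pi> \<longleftrightarrow> stack_output [2, 1] (stack_output \<sigma> \<pi>) = [1..<Suc (length \<pi>)]"

definition Sort :: "nat list \<Rightarrow> nat list set" where
  "Sort \<sigma> = {\<pi> \<in> perms. sortable \<sigma> \<pi>}"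

end

theory Submission
  imports Defs "HOL-Computational_Algebra.Formal_Power_Series"
begin

text \<open>For \<open>\<sigma> = a # b # \<tau>\<close> let the swap of \<open>\<sigma>\<close> be \<open>b # a # \<tau>\<close>. The theorem follows from the
  dichotomy that, for \<open>\<sigma>\<close> of length at least three, \<open>Sort \<sigma>\<close> is a class if and only if the
  swap of \<open>\<sigma>\<close> contains 231 (\<open>class_iff_swap_contains_231\<close>). Swapping is an involution, so the
  patterns to be counted are equinumerous with the permutations avoiding 231, whose number is a
  Catalan number (\<open>card_avoiders\<close>).

  The classical stack sorts exactly the words that avoid 231, so \<open>\<pi>\<close> is \<open>\<sigma>\<close>-sortable if and only
  if the output of the \<open>\<sigma>\<close>-stack avoids 231. If \<open>rev \<pi>\<close> avoids \<open>\<sigma>\<close>, the restriction never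
  applies and this output is \<open>rev \<pi>\<close>. Otherwise, at the first letter \<open>x\<close> that forces a pop, the
  last letter \<open>y\<close> popped plays the role of \<open>b\<close> in an occurrence of \<open>\<sigma>\<close> in which \<open>x\<close> plays the
  role of \<open>a\<close>. It leaves before \<open>x\<close>, whereas the rest of the occurrence stays below \<open>x\<close>. Hence
  the output contains the swap of \<open>\<sigma>\<close> (\<open>output_contains_swap\<close>). If the swap contains 231,
  then \<open>Sort \<sigma>\<close> consists of the permutations whose reversals avoid both \<open>\<sigma>\<close> and 231, and this
  is a class.

  If the swap avoids 231, a sortable permutation containing an unsortable one is needed. Unless
  \<open>\<sigma>\<close> is 231 itself, the permutation 132 is unsortable, because its reversal avoids \<open>\<sigma>\<close>. A
  sortable permutation containing 132 depends on where the letter 1 of \<open>\<sigma>\<close> stands. If it is in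
  one of the first two places and \<open>c\<close> is the other letter there, the reversal of
  \<open>2 # Suc c # 1 # map Suc \<tau>\<close> is such a permutation. If it is further back, then \<open>a < b\<close>,
  since otherwise \<open>b\<close>, \<open>a\<close>, 1 would form a 231 in the swap; now \<open>a\<close>, \<open>b\<close>, 1 form a 231 in
  \<open>\<sigma>\<close>, so \<open>rev \<sigma>\<close> contains 132, and the \<open>\<sigma>\<close>-stack turns \<open>rev \<sigma>\<close> into the swap. For the
  pattern 231 a specific pair of permutations does the job.\<close>

section \<open>Order isomorphism and pattern containment\<close>

lemma order_isomorphic_Nil [simp]:
  "order_isomorphic [] ys \<longleftrightarrow> ys = []" "order_isomorphic xs [] \<longleftrightarrow> xs = []"
  by (auto simp: order_isomorphic_def)

lemma order_isomorphic_Cons [simp]: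
  "order_isomorphic (x # xs) (y # ys) \<longleftrightarrow> order_isomorphic xs ys \<and>
     list_all2 (\<lambda>u v. (x < u \<longleftrightarrow> y < v) \<and> (u < x \<longleftrightarrow> v < y)) xs ys"
  by (auto simp: order_isomorphic_def list_all2_conv_all_nth All_less_Suc2)

lemma order_isomorphic_length: "order_isomorphic xs ys \<Longrightarrow> length xs = length ys"
  by (simp add: order_isomorphic_def)

lemma order_isomorphic_refl: "order_isomorphic xs xs"
  by (simp add: order_isomorphic_def)

lemma order_isomorphic_sym: "order_isomorphic xs ys \<Longrightarrow> order_isomorphic ys xs"
  by (simp add: order_isomorphic_def)

lemma order_isomorphic_trans:
  "order_isomorphic xs ys \<Longrightarrow> order_isomorphic ys zs \<Longrightarrow> order_isomorphic xs zs"
  by (simp add: order_isomorphic_def)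

lemma order_isomorphic_rev:
  assumes "order_isomorphic xs ys"
  shows "order_isomorphic (rev xs) (rev ys)"
  using assms by (auto simp: order_isomorphic_def rev_nth)

lemma order_isomorphic_map_Suc: "order_isomorphic (map Suc xs) xs"
  by (simp add: order_isomorphic_def)

lemma order_isomorphic_iff_zip:
  "order_isomorphic xs ys \<longleftrightarrow> length xs = length ys \<and>
     (\<forall>p\<in>set (zip xs ys). \<forall>q\<in>set (zip xs ys). fst p < fst q \<longleftrightarrow> snd p < snd q)"
  unfolding order_isomorphic_def by (fastforce simp: set_zip)

text \<open>Pairing the two words position by position lets the positions selected in one word be
  selected in the other as well.\<close>

lemma subseq_transfer:
  assumes "subseq zs xs" "order_isomorphic xs ys"
  obtains us where "subseq us ys" "order_isomorphic us zs"
proof -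
  obtain N where N: "zs = nths xs N"
    using assms(1) by (auto simp: subseq_conv_nths)
  define ps where "ps = nths (zip xs ys) N"
  have len: "length xs = length ys"
    using assms(2) by (rule order_isomorphic_length)
  have fst: "map fst ps = zs" and snd: "map snd ps = nths ys N"
    using len by (simp_all add: ps_def N nths_map[symmetric])
  have zip: "zip zs (nths ys N) = ps"
    by (metis fst snd zip_map_fst_snd)
  have "set ps \<subseteq> set (zip xs ys)"
    unfolding ps_def by (rule set_nths_subset)
  moreover have "length zs = length (nths ys N)"
    by (metis fst snd length_map)
  ultimately have "order_isomorphic zs (nths ys N)"
    using assms(2) unfolding order_isomorphic_iff_zip zip by blast
  then show thesis
    using that order_isomorphic_sym by (auto simp: subseq_conv_nths)
qed

lemma contains_pattern_subseq:
  "contains_pattern xs \<tau> \<Longrightarrow> subseq xs ys \<Longrightarrow> contains_pattern ys \<tau>"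
  unfolding contains_pattern_def using subseq_order.trans by blast

lemma contains_pattern_trans:
  assumes "contains_pattern w \<pi>" "contains_pattern \<pi> \<tau>"
  shows "contains_pattern w \<tau>"
proof -
  obtain ys zs where ys: "subseq ys w" "order_isomorphic ys \<pi>"
    and zs: "subseq zs \<pi>" "order_isomorphic zs \<tau>"
    using assms by (auto simp: contains_pattern_def)
  obtain us where us: "subseq us ys" "order_isomorphic us zs"
    by (rule subseq_transfer[OF zs(1) order_isomorphic_sym[OF ys(2)]])
  have "subseq us w" "order_isomorphic us \<tau>"
    using subseq_order.trans[OF us(1) ys(1)] order_isomorphic_trans[OF us(2) zs(2)] by auto
  then show ?thesis
    unfolding contains_pattern_def by blast
qed

lemma subseq_rev: "subseq xs ys \<Longrightarrow> subseq (rev xs) (rev ys)"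
  by (induction rule: list_emb.induct) (auto intro: list_emb_append_mono)

lemma contains_pattern_rev: "contains_pattern w \<tau> \<Longrightarrow> contains_pattern (rev w) (rev \<tau>)"
  unfolding contains_pattern_def by (meson order_isomorphic_rev subseq_rev)

lemma order_isomorphic_imp_contains: "order_isomorphic w \<tau> \<Longrightarrow> contains_pattern w \<tau>"
  by (auto simp: contains_pattern_def)

lemma contains_pattern_length: "contains_pattern w \<tau> \<Longrightarrow> length \<tau> \<le> length w"
  unfolding contains_pattern_def by (metis list_emb_length order_isomorphic_length)

lemma contains_pattern_same_length:
  assumes "length w = length \<tau>"
  shows "contains_pattern w \<tau> \<longleftrightarrow> order_isomorphic w \<tau>"
  using assms unfolding contains_pattern_def
  by (metis order_isomorphic_length subseq_same_length subseq_order.order_refl)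

lemma order_isomorphic_21: "order_isomorphic ys [2, 1] \<longleftrightarrow> (\<exists>b a. ys = [b, a] \<and> a < b)"
  by (cases ys rule: remdups_adj.cases) (auto simp: order_isomorphic_def less_Suc_eq)

lemma order_isomorphic_231:
  "order_isomorphic ys [2, 3, 1] \<longleftrightarrow> (\<exists>b c a. ys = [b, c, a] \<and> a < b \<and> b < c)"
proof
  assume iso: "order_isomorphic ys [2, 3, 1]"
  then have "length ys = 3" by (auto dest: order_isomorphic_length)
  then obtain b c a where "ys = [b, c, a]"
    by (auto simp: numeral_eq_Suc length_Suc_conv)
  with iso show "\<exists>b c a. ys = [b, c, a] \<and> a < b \<and> b < c" by auto
qed auto

lemma contains_21_iff: "contains_pattern w [2, 1] \<longleftrightarrow> (\<exists>b a. subseq [b, a] w \<and> a < b)"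
  unfolding contains_pattern_def order_isomorphic_21 by blast

text \<open>A separate name for containment of 231 shields the literal pattern from the simplifier,
  which rewrites its last letter to \<open>Suc 0\<close> and would then miss rules stated with \<open>[2, 3, 1]\<close>.\<close>

definition contains_231 :: "nat list \<Rightarrow> bool" where
  "contains_231 w \<longleftrightarrow> (\<exists>b c a. subseq [b, c, a] w \<and> a < b \<and> b < c)"

lemma contains_pattern_231: "contains_pattern w [2, 3, 1] \<longleftrightarrow> contains_231 w"
  unfolding contains_231_def contains_pattern_def order_isomorphic_231 by blast

lemma contains_231_Nil [simp]: "\<not> contains_231 []"
  by (simp add: contains_231_def)

lemma subseq_Cons_Cons_iff:
  "subseq (a # as) (b # bs) \<longleftrightarrow> (a = b \<and> subseq as bs) \<or> subseq (a # as) bs"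
  by (auto dest: subseq_Cons')

lemma contains_231_Cons:
  "contains_231 (x # w) \<longleftrightarrow>
     contains_231 w \<or> (\<exists>c a. subseq [c, a] w \<and> a < x \<and> x < c)"
  unfolding contains_231_def subseq_Cons_Cons_iff by blast

lemma subseq_pair_Cons: "subseq [c, a] (x # w) \<longleftrightarrow> (c = x \<and> a \<in> set w) \<or> subseq [c, a] w"
  unfolding subseq_Cons_Cons_iff subseq_singleton_left by blast

lemma subseq_pair_set: "subseq [c, a] w \<Longrightarrow> c \<in> set w \<and> a \<in> set w"
  by (induction w) (auto simp: subseq_pair_Cons simp del: subseq_Cons2_iff)

lemma subseq_pair_append:
  "subseq [c, a] (u @ v) \<longleftrightarrow> subseq [c, a] u \<or> (c \<in> set u \<and> a \<in> set v) \<or> subseq [c, a] v"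
  by (induction u) (auto simp: subseq_pair_Cons simp del: subseq_Cons2_iff)

lemma subseq_snoc_iff:
  "subseq (as @ [a]) (bs @ [b]) \<longleftrightarrow> (a = b \<and> subseq as bs) \<or> subseq (as @ [a]) bs"
  using subseq_Cons_Cons_iff[of a "rev as" b "rev bs"] subseq_rev
  by (metis rev.simps(2) rev_rev_ident)

lemma subseq_pair_snoc: "subseq [b, c] (w @ [x]) \<longleftrightarrow> (c = x \<and> b \<in> set w) \<or> subseq [b, c] w"
  using subseq_snoc_iff[of "[b]" c w x] by (auto simp: subseq_singleton_left)

lemma contains_231_snoc:
  "contains_231 (w @ [x]) \<longleftrightarrow>
     contains_231 w \<or> (\<exists>b c. subseq [b, c] w \<and> x < b \<and> b < c)"
proof -
  have "subseq [b, c, a] (w @ [x]) \<longleftrightarrow> (a = x \<and> subseq [b, c] w) \<or> subseq [b, c, a] w" for b c a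
    using subseq_snoc_iff[of "[b, c]" a w x] by simp
  then show ?thesis
    by (auto simp: contains_231_def)
qed

lemma contains_231_map_Suc [simp]:
  "contains_231 (map Suc w) \<longleftrightarrow> contains_231 w"
proof -
  have "contains_pattern w (map Suc w)" "contains_pattern (map Suc w) w"
    by (simp_all add: order_isomorphic_imp_contains order_isomorphic_map_Suc order_isomorphic_sym)
  then show ?thesis
    using contains_pattern_trans unfolding contains_pattern_231[symmetric] by blast
qed

section \<open>One step of a restricted stack\<close>

text \<open>The two implications record why popping went as far as \<open>us\<close>, and why it stopped there.\<close>

lemma pop_for_split:
  obtains us vs where "st = us @ vs" "pop_for \<sigma> x (st, out) = (vs, out @ us)"
    "us \<noteq> [] \<Longrightarrow> contains_pattern (x # last us # vs) \<sigma>"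
    "vs \<noteq> [] \<Longrightarrow> \<not> contains_pattern (x # vs) \<sigma>"
proof (induction st arbitrary: out thesis)
  case Nil
  show ?case by (rule Nil[of "[]" "[]"]) auto
next
  case (Cons s st)
  show ?case
  proof (cases "contains_pattern (x # s # st) \<sigma>")
    case True
    obtain us vs where *: "st = us @ vs" "pop_for \<sigma> x (st, out @ [s]) = (vs, (out @ [s]) @ us)"
      "us \<noteq> [] \<Longrightarrow> contains_pattern (x # last us # vs) \<sigma>"
      "vs \<noteq> [] \<Longrightarrow> \<not> contains_pattern (x # vs) \<sigma>"
      using Cons.IH by blast
    show ?thesis
      by (rule Cons.prems[of "s # us" vs]) (use * True in auto)
  next
    case False
    show ?thesis
      by (rule Cons.prems[of "[]" "s # st"]) (use False in auto)
  qed
qed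

lemma push_letter_split:
  obtains us vs where "st = us @ vs" "push_letter \<sigma> x (st, out) = (x # vs, out @ us)"
    "us \<noteq> [] \<Longrightarrow> contains_pattern (x # last us # vs) \<sigma>"
    "vs \<noteq> [] \<Longrightarrow> \<not> contains_pattern (x # vs) \<sigma>"
  by (rule pop_for_split[of st \<sigma> x out]) (auto simp: push_letter_def)

lemma push_letter_free:
  "\<not> contains_pattern (x # st) \<sigma> \<Longrightarrow> push_letter \<sigma> x (st, out) = (x # st, out)"
  by (cases st) (auto simp: push_letter_def)

lemma push_letter_pop_one:
  "contains_pattern (x # s # st) \<sigma> \<Longrightarrow> \<not> contains_pattern (x # st) \<sigma> \<Longrightarrow>
     push_letter \<sigma> x (s # st, out) = (x # st, out @ [s])"
  by (cases st) (auto simp: push_letter_def)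

lemma fold_push_letter_free:
  "\<not> contains_pattern (rev p @ st) \<sigma> \<Longrightarrow> fold (push_letter \<sigma>) p (st, out) = (rev p @ st, out)"
proof (induction p arbitrary: st)
  case (Cons x p)
  have "\<not> contains_pattern (x # st) \<sigma>"
    using Cons.prems contains_pattern_subseq[of "x # st" \<sigma> "rev p @ x # st"] by auto
  with Cons show ?case by (simp add: push_letter_free)
qed auto

lemma stack_output_free: "\<not> contains_pattern (rev \<pi>) \<sigma> \<Longrightarrow> stack_output \<sigma> \<pi> = rev \<pi>"
  by (simp add: stack_output_def fold_push_letter_free)

lemma mset_fold_push_letter:
  "fold (push_letter \<sigma>) p (st, out) = (st', out') \<Longrightarrow> mset (out' @ st') = mset (out @ st) + mset p"
proof (induction p arbitrary: st out)
  case (Cons x p)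
  obtain us vs where "st = us @ vs" "push_letter \<sigma> x (st, out) = (x # vs, out @ us)"
    by (rule push_letter_split)
  with Cons.IH[of "x # vs" "out @ us"] Cons.prems show ?case by simp
qed auto

lemma mset_stack_output: "mset (stack_output \<sigma> \<pi>) = mset \<pi>"
  using mset_fold_push_letter[of \<sigma> \<pi> "[]" "[]"]
  by (auto simp: stack_output_def split: prod.splits)

section \<open>The classical stack\<close>

lemma contains_21_Cons_sorted:
  "sorted st \<Longrightarrow> contains_pattern (x # st) [2, 1] \<longleftrightarrow> (\<exists>s\<in>set st. s < x)"
proof (induction st arbitrary: x)
  case Nil
  then show ?case by (auto dest: contains_pattern_length)
next
  case (Cons s st)
  have "\<not> contains_pattern (s # st) [2, 1]"
    using Cons by force
  then show ?case
    unfolding contains_21_iff subseq_pair_Cons[of _ _ x] by blast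
qed

text \<open>On a sorted stack, containing 21 after the push of \<open>x\<close> means that some letter of the stack
  is below \<open>x\<close>. Hence exactly the letters smaller than \<open>x\<close> are popped.\<close>

lemma classical_push_letter:
  assumes "sorted st"
  obtains us vs where "st = us @ vs" "push_letter [2, 1] x (st, out) = (x # vs, out @ us)"
    "\<forall>u\<in>set us. u < x" "\<forall>v\<in>set vs. x \<le> v"
proof -
  obtain us vs where *: "st = us @ vs" "push_letter [2, 1] x (st, out) = (x # vs, out @ us)"
    "us \<noteq> [] \<Longrightarrow> contains_pattern (x # last us # vs) [2, 1]"
    "vs \<noteq> [] \<Longrightarrow> \<not> contains_pattern (x # vs) [2, 1]"
    by (rule push_letter_split[of st "[2, 1]" x out]) blast
  have sorted: "sorted us" "sorted vs" "\<forall>u\<in>set us. \<forall>v\<in>set vs. u \<le> v"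
    using assms * by (auto simp: sorted_append)
  have "x \<le> v" if "v \<in> set vs" for v
    using that *(4) contains_21_Cons_sorted[OF sorted(2), of x] by force
  moreover have "u < x" if "u \<in> set us" for u
  proof -
    have ne: "us \<noteq> []" using that by auto
    have "sorted (last us # vs)" using sorted ne by auto
    then have "\<exists>s\<in>set (last us # vs). s < x"
      using *(3)[OF ne] contains_21_Cons_sorted by blast
    then have "last us < x" using sorted ne by (metis last_in_set order_le_less_trans set_ConsD)
    moreover have "u \<le> last us"
      using that sorted(1) ne by (cases us rule: rev_cases) (auto simp: sorted_append)
    ultimately show ?thesis by simp
  qed
  ultimately show thesis using that * by blast
qed

text \<open>A letter has left the stack exactly when a larger letter followed it in the input. The
  concatenation of output and stack therefore loses its sortedness exactly when the letter being
  pushed is smaller than some letter that has left, that is, when it completes a 231.\<close>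

lemma classical_stack_invariant:
  assumes "fold (push_letter [2, 1]) p ([], []) = (st, out)"
  shows "sorted st \<and> set p = set out \<union> set st \<and>
    (\<forall>b. b \<in> set out \<longleftrightarrow> (\<exists>c>b. subseq [b, c] p)) \<and>
    (sorted (out @ st) \<longleftrightarrow> \<not> contains_231 p)"
  using assms
proof (induction p arbitrary: st out rule: rev_induct)
  case Nil
  then show ?case by (simp add: contains_231_def)
next
  case (snoc x p)
  obtain st0 out0 where 0: "fold (push_letter [2, 1]) p ([], []) = (st0, out0)"
    by fastforce
  note IH = snoc.IH[OF 0]
  obtain us vs where s: "st0 = us @ vs" "push_letter [2, 1] x (st0, out0) = (x # vs, out0 @ us)"
    "\<forall>u\<in>set us. u < x" "\<forall>v\<in>set vs. x \<le> v"
    by (rule classical_push_letter[of st0 x out0]) (use IH in blast)+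
  have eq: "st = x # vs" "out = out0 @ us"
    using snoc.prems 0 s by auto
  have "sorted st"
    using IH s by (auto simp: eq sorted_append)
  moreover have "set (p @ [x]) = set out \<union> set st"
    using IH s by (auto simp: eq)
  moreover have "\<forall>b. b \<in> set out \<longleftrightarrow> (\<exists>c>b. subseq [b, c] (p @ [x]))"
    using IH s unfolding eq subseq_pair_snoc by (auto simp: leD)
  moreover have "sorted (out @ st) \<longleftrightarrow> \<not> contains_231 (p @ [x])"
  proof -
    have "sorted (out @ st) \<longleftrightarrow> sorted (out0 @ st0) \<and> (\<forall>b\<in>set out0. b \<le> x)"
      using s by (fastforce simp: eq sorted_append)
    also have "\<dots> \<longleftrightarrow> \<not> contains_231 (p @ [x])"
      using IH unfolding contains_231_snoc by (meson linorder_not_less)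
    finally show ?thesis .
  qed
  ultimately show ?case by blast
qed

lemma sorted_classical_output:
  "sorted (stack_output [2, 1] w) \<longleftrightarrow> \<not> contains_231 w"
  using classical_stack_invariant[of w]
  by (cases "fold (push_letter [2, 1]) w ([], [])") (auto simp: stack_output_def)

lemma perms_of_length_iff: "\<pi> \<in> perms_of_length n \<longleftrightarrow> distinct \<pi> \<and> set \<pi> = {1..n}"
  by (auto simp: perms_of_length_def permutations_of_set_def)

lemma length_perms_of_length: "\<pi> \<in> perms_of_length n \<Longrightarrow> length \<pi> = n"
  using distinct_card[of \<pi>] by (simp add: perms_of_length_iff)

lemma perms_iff: "\<pi> \<in> perms \<longleftrightarrow> distinct \<pi> \<and> set \<pi> = {1..length \<pi>}"
  by (metis UN_iff UNIV_I length_perms_of_length perms_def perms_of_length_iff)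

lemma mset_perms:
  assumes "\<pi> \<in> perms"
  shows "mset \<pi> = mset [1..<Suc (length \<pi>)]"
proof -
  have "set \<pi> = set [1..<Suc (length \<pi>)]"
    using assms by (simp only: perms_iff set_upt atLeastLessThanSuc_atLeastAtMost)
  then show ?thesis
    using assms set_eq_iff_mset_eq_distinct[OF _ distinct_upt] perms_iff by metis
qed

lemma sortable_iff:
  assumes "\<pi> \<in> perms"
  shows "sortable \<sigma> \<pi> \<longleftrightarrow> \<not> contains_231 (stack_output \<sigma> \<pi>)"
proof -
  let ?w = "stack_output [2, 1] (stack_output \<sigma> \<pi>)"
  have "mset ?w = mset [1..<Suc (length \<pi>)]"
    using mset_perms[OF assms] by (simp add: mset_stack_output)
  then have "sorted ?w \<longleftrightarrow> ?w = [1..<Suc (length \<pi>)]"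
    by (metis properties_for_sort sorted_sort_id sorted_upt)
  then show ?thesis
    unfolding sortable_def sorted_classical_output by simp
qed

section \<open>Patterns whose swap contains 231\<close>

text \<open>Once the concatenation of output and stack contains a word, it always will: popping leaves
  it unchanged, and pushing inserts one letter. So only the first letter \<open>x\<close> that completes an
  occurrence of the pattern matters. Before the last pop there is an occurrence of the pattern in
  \<open>x # y # vs\<close>, and there is none in \<open>x # vs\<close> or in \<open>y # vs\<close>, so it uses both \<open>x\<close> and \<open>y\<close>.
  In the output \<open>y\<close> precedes \<open>x\<close>.\<close>

lemma output_contains_swap:
  assumes "fold (push_letter (a # b # \<tau>)) p ([], []) = (st, out)"
    and "contains_pattern (rev p) (a # b # \<tau>)"
  shows "contains_pattern (out @ st) (b # a # \<tau>)"
  using assms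
proof (induction p arbitrary: st out rule: rev_induct)
  case Nil
  then show ?case by (auto dest: contains_pattern_length)
next
  case (snoc x p)
  let ?\<sigma> = "a # b # \<tau>"
  obtain st0 out0 where 0: "fold (push_letter ?\<sigma>) p ([], []) = (st0, out0)"
    by fastforce
  obtain us vs where s: "st0 = us @ vs" "push_letter ?\<sigma> x (st0, out0) = (x # vs, out0 @ us)"
    "us \<noteq> [] \<Longrightarrow> contains_pattern (x # last us # vs) ?\<sigma>"
    "vs \<noteq> [] \<Longrightarrow> \<not> contains_pattern (x # vs) ?\<sigma>"
    by (rule push_letter_split[of st0 ?\<sigma> x out0]) blast
  have eq: "st = x # vs" "out = out0 @ us"
    using snoc.prems 0 s by auto
  show ?case
  proof (cases "contains_pattern (rev p) ?\<sigma>")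
    case True
    then have "contains_pattern (out0 @ st0) (b # a # \<tau>)"
      using snoc.IH 0 by blast
    then show ?thesis
      by (rule contains_pattern_subseq) (auto simp: s eq intro!: list_emb_append_mono)
  next
    case False
    have st0: "st0 = rev p"
      using fold_push_letter_free[of p "[]" ?\<sigma> "[]"] False 0 by simp
    \<comment> \<open>The stack may have been emptied, but a single letter is too short for the pattern.\<close>
    have no_x: "\<not> contains_pattern (x # vs) ?\<sigma>"
      using s(4) contains_pattern_length[of "[x]" ?\<sigma>] by (cases "vs = []") auto
    have "contains_pattern (x # rev p) ?\<sigma>"
      using snoc.prems by simp
    then have ne: "us \<noteq> []"
      using no_x s(1) st0 by auto
    define y where "y = last us"
    have us: "us = butlast us @ [y]"
      using ne by (simp add: y_def)
    have "subseq (y # vs) (rev p)"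
      unfolding st0[symmetric] s(1) by (subst us) (simp add: list_emb_append2)
    then have no_y: "\<not> contains_pattern (y # vs) ?\<sigma>"
      using False contains_pattern_subseq by blast
    obtain ys where ys: "subseq ys (x # y # vs)" "order_isomorphic ys ?\<sigma>"
      using s(3)[OF ne] by (auto simp: contains_pattern_def y_def)
    obtain z1 z2 ws where ws: "ys = z1 # z2 # ws"
      using order_isomorphic_length[OF ys(2)] by (auto simp: length_Suc_conv)
    have "\<not> subseq ys (y # vs)" "\<not> subseq ys (x # vs)"
      using no_x no_y ys(2) by (auto simp: contains_pattern_def)
    then have z: "z1 = x" "z2 = y" "subseq ws vs"
      using ys(1) unfolding ws subseq_Cons_Cons_iff by blast+
    have "order_isomorphic (y # x # ws) (b # a # \<tau>)"
      using ys(2) by (auto simp: ws z)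
    moreover have "subseq (y # x # ws) (out @ st)"
      unfolding eq by (subst us) (use z in auto)
    ultimately show ?thesis
      by (auto simp: contains_pattern_def)
  qed
qed

text \<open>If the reversal contains the pattern, the output contains its swap, hence also 231.\<close>

lemma sortable_iff_avoids:
  assumes "contains_231 (b # a # \<tau>)" "\<pi> \<in> perms"
  shows "sortable (a # b # \<tau>) \<pi> \<longleftrightarrow>
    \<not> contains_pattern (rev \<pi>) (a # b # \<tau>) \<and> \<not> contains_231 (rev \<pi>)"
proof (cases "contains_pattern (rev \<pi>) (a # b # \<tau>)")
  case True
  then have "contains_pattern (stack_output (a # b # \<tau>) \<pi>) (b # a # \<tau>)"
    using output_contains_swap[of a b \<tau> \<pi>]
    by (cases "fold (push_letter (a # b # \<tau>)) \<pi> ([], [])") (auto simp: stack_output_def)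
  then have "contains_231 (stack_output (a # b # \<tau>) \<pi>)"
    using assms(1) contains_pattern_trans unfolding contains_pattern_231[symmetric] by blast
  then show ?thesis
    using True assms(2) by (simp add: sortable_iff)
next
  case False
  then show ?thesis
    using assms(2) by (simp add: sortable_iff stack_output_free)
qed

lemma class_if_swap_contains_231:
  assumes "contains_231 (b # a # \<tau>)"
  shows "permutation_class (Sort (a # b # \<tau>))"
  unfolding permutation_class_def
proof (intro conjI ballI impI)
  show "Sort (a # b # \<tau>) \<subseteq> perms" by (auto simp: Sort_def)
next
  fix \<pi> \<rho> assume "\<pi> \<in> Sort (a # b # \<tau>)" and \<rho>: "\<rho> \<in> perms" "contains_pattern \<pi> \<rho>"
  then have \<pi>: "\<not> contains_pattern (rev \<pi>) (a # b # \<tau>)" "\<not> contains_231 (rev \<pi>)"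
    using sortable_iff_avoids[OF assms] by (auto simp: Sort_def)
  have "contains_pattern (rev \<pi>) (rev \<rho>)"
    using \<rho> by (simp add: contains_pattern_rev)
  then have "\<not> contains_pattern (rev \<rho>) (a # b # \<tau>)" "\<not> contains_231 (rev \<rho>)"
    using \<pi> contains_pattern_trans unfolding contains_pattern_231[symmetric] by blast+
  then show "\<rho> \<in> Sort (a # b # \<tau>)"
    using sortable_iff_avoids[OF assms] \<rho> by (auto simp: Sort_def)
qed

section \<open>Patterns whose swap avoids 231\<close>

lemma perm_132: "[1, 3, 2] \<in> perms"
  by (auto simp: perms_iff)

text \<open>The last assumption ensures that the \<open>\<sigma>\<close>-stack reverses 132, which makes 132 unsortable.\<close>

lemma not_class_witness:
  assumes "\<pi> \<in> perms" "\<not> contains_231 (stack_output \<sigma> \<pi>)" "contains_231 (rev \<pi>)"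
    and "\<not> contains_pattern [2, 3, 1] \<sigma>"
  shows "\<not> permutation_class (Sort \<sigma>)"
proof -
  have "stack_output \<sigma> [1, 3, 2] = [2, 3, 1]"
    using stack_output_free[of "[1, 3, 2]" \<sigma>] assms(4) by simp
  moreover have "contains_231 [2, 3, 1]"
    unfolding contains_231_def by (intro exI[of _ 2] exI[of _ 3] exI[of _ 1]) simp
  ultimately have "[1, 3, 2] \<notin> Sort \<sigma>"
    using sortable_iff[OF perm_132, of \<sigma>] by (auto simp: Sort_def)
  moreover have "contains_pattern \<pi> [1, 3, 2]"
    using contains_pattern_rev[OF assms(3)[folded contains_pattern_231]] by simp
  moreover have "\<pi> \<in> Sort \<sigma>"
    using assms by (simp add: Sort_def sortable_iff)
  ultimately show ?thesis
    using perm_132 unfolding permutation_class_def by blast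
qed

text \<open>The only pattern of length at least three that 231 contains is 231 itself; this form
  compares the letters directly.\<close>

lemma pattern_in_231:
  assumes "contains_pattern [2, 3, 1] (a # b # \<tau>)" "\<tau> \<noteq> []"
  obtains t where "\<tau> = [t]" "t < a" "a < b"
proof -
  obtain t where t: "\<tau> = [t]"
    using contains_pattern_length[OF assms(1)] assms(2) by (cases \<tau>) auto
  then have "order_isomorphic [2, 3, 1] [a, b, t]"
    using assms(1) contains_pattern_same_length[of "[2, 3, 1]" "[a, b, t]"] by simp
  then show thesis
    using that t by simp
qed

text \<open>The witness for patterns that have 1 in one of the first two places, \<open>c\<close> being the other
  letter there: all letters are raised by one, so that the old 1 becomes a 2, and a new 1 is
  inserted right after \<open>Suc c\<close>.\<close>

lemma witness_in_perms:
  assumes "distinct (a # b # \<tau>)" "set (a # b # \<tau>) = {1..n}" "c = a \<or> c = b" "1 \<in> {a, b}" "c \<noteq> 1"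
  shows "rev (2 # Suc c # 1 # map Suc \<tau>) \<in> perms"
proof -
  have \<tau>: "1 \<notin> set \<tau>" "c \<notin> set \<tau>" "distinct \<tau>"
    using assms(1,3-5) by auto
  have n: "{1..n} = {1, c} \<union> set \<tau>"
    unfolding assms(2)[symmetric] using assms(3-5) by auto
  then have "set (2 # Suc c # 1 # map Suc \<tau>) = insert 1 (Suc ` {1..n})"
    by (simp add: image_Un numeral_2_eq_2 insert_commute)
  also have "\<dots> = {1..Suc n}"
    by (auto simp: image_Suc_atLeastAtMost)
  finally have "set (2 # Suc c # 1 # map Suc \<tau>) = {1..Suc n}" .
  moreover have "distinct (2 # Suc c # 1 # map Suc \<tau>)"
  proof -
    have "0 \<notin> {1, c} \<union> set \<tau>"
      unfolding n[symmetric] by simp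
    then show ?thesis
      using \<tau> assms(5) by (auto simp: distinct_map)
  qed
  ultimately show ?thesis
    unfolding perms_def perms_of_length_iff UN_iff set_rev distinct_rev by blast
qed

lemma witness_contains_231: "1 < c \<Longrightarrow> contains_231 (2 # Suc c # 1 # w)"
  unfolding contains_231_def
  by (intro exI[of _ 2] exI[of _ "Suc c"] exI[of _ 1]) simp

text \<open>The new letter 1 does not trigger the restriction, since the pattern starts with its minimum
  and a word of the same length with a smaller letter after its first one cannot match it. The
  letter 2 then completes the raised pattern, and one pop is enough. The output is the raised swap
  with 1 inserted behind the descent from \<open>Suc b\<close> to 2, where 1 cannot complete a 231.\<close>

lemma not_class_if_starts_with_1:
  assumes "distinct (1 # b # \<tau>)" "set (1 # b # \<tau>) = {1..n}" "\<tau> \<noteq> []"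
    and "\<not> contains_231 (b # 1 # \<tau>)"
  shows "\<not> permutation_class (Sort (1 # b # \<tau>))"
proof -
  let ?\<sigma> = "1 # b # \<tau>" and ?T = "map Suc \<tau>"
  let ?\<pi> = "rev (2 # Suc b # 1 # ?T)"
  have "\<forall>t\<in>set (1 # b # \<tau>). 1 \<le> t"
    unfolding assms(2) by simp
  then have b: "1 < b" and \<tau>: "\<forall>t\<in>set \<tau>. 1 < t"
    using assms(1) by (auto intro: le_neq_implies_less)
  have "order_isomorphic (2 # Suc b # ?T) ?\<sigma>"
    using order_isomorphic_map_Suc[of ?\<sigma>] by (simp add: numeral_2_eq_2)
  then have trigger: "contains_pattern (2 # Suc b # 1 # ?T) ?\<sigma>"
    by (rule contains_pattern_subseq[OF order_isomorphic_imp_contains]) auto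
  have free: "\<not> contains_pattern (Suc b # 1 # ?T) ?\<sigma>" "\<not> contains_pattern (2 # 1 # ?T) ?\<sigma>"
    using b by (simp_all add: contains_pattern_same_length)
  have "fold (push_letter ?\<sigma>) (rev (Suc b # 1 # ?T)) ([], []) = (Suc b # 1 # ?T, [])"
    using fold_push_letter_free[of "rev (Suc b # 1 # ?T)" "[]" ?\<sigma> "[]"] free by simp
  then have "fold (push_letter ?\<sigma>) ?\<pi> ([], []) = (2 # 1 # ?T, [Suc b])"
    using push_letter_pop_one[OF trigger free(2)] by simp
  then have out: "stack_output ?\<sigma> ?\<pi> = Suc b # 2 # 1 # ?T"
    by (simp add: stack_output_def)
  have "\<not> contains_231 (Suc b # 2 # ?T)"
    using assms(4) contains_231_map_Suc[of "b # 1 # \<tau>"] by (simp add: numeral_2_eq_2)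
  moreover have "1 < t" if "subseq [c, t] ?T" for c t
    using subseq_pair_set[OF that] \<tau> by auto
  ultimately have "\<not> contains_231 (Suc b # 2 # 1 # ?T)"
    using b by (fastforce simp: contains_231_Cons subseq_pair_Cons)
  moreover have "\<not> contains_pattern [2, 3, 1] ?\<sigma>"
    using pattern_in_231[of 1 b \<tau>] assms(3) \<tau> by force
  moreover have "?\<pi> \<in> perms"
    using assms(1,2) b by (intro witness_in_perms[of 1 b]) auto
  moreover have "contains_231 (rev ?\<pi>)"
    using witness_contains_231[OF b] by simp
  ultimately show ?thesis
    using not_class_witness[of ?\<pi> ?\<sigma>, unfolded out] by blast
qed

text \<open>Here the new 1 plays the role of the minimum of the pattern, so it is popped when \<open>Suc a\<close>
  arrives. The letter 2 can be put on top of \<open>Suc a\<close>, as the pattern starts with a descent. The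
  output is the raised swap with 1 in front.\<close>

lemma not_class_if_second_is_1:
  assumes "distinct (a # 1 # \<tau>)" "set (a # 1 # \<tau>) = {1..n}" "\<tau> \<noteq> []"
    and "\<not> contains_231 (1 # a # \<tau>)"
  shows "\<not> permutation_class (Sort (a # 1 # \<tau>))"
proof -
  let ?\<sigma> = "a # 1 # \<tau>" and ?T = "map Suc \<tau>"
  let ?\<pi> = "rev (2 # Suc a # 1 # ?T)"
  have "\<forall>t\<in>set (a # 1 # \<tau>). 1 \<le> t"
    unfolding assms(2) by simp
  then have a: "1 < a" and \<tau>: "\<forall>t\<in>set \<tau>. 1 < t"
    using assms(1) by (auto intro: le_neq_implies_less)
  have "order_isomorphic (Suc a # 1 # ?T) ?\<sigma>"
    using \<tau> a by (auto simp: order_isomorphic_map_Suc list.rel_map list_all2_same)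
  then have trigger: "contains_pattern (Suc a # 1 # ?T) ?\<sigma>"
    by (rule order_isomorphic_imp_contains)
  have free: "\<not> contains_pattern (1 # ?T) ?\<sigma>" "\<not> contains_pattern (Suc a # ?T) ?\<sigma>"
    by (auto dest: contains_pattern_length)
  have free': "\<not> contains_pattern (2 # Suc a # ?T) ?\<sigma>"
    using a by (simp add: contains_pattern_same_length)
  have "fold (push_letter ?\<sigma>) (rev (1 # ?T)) ([], []) = (1 # ?T, [])"
    using fold_push_letter_free[of "rev (1 # ?T)" "[]" ?\<sigma> "[]"] free by simp
  then have "fold (push_letter ?\<sigma>) ?\<pi> ([], []) = (2 # Suc a # ?T, [1])"
    using push_letter_pop_one[OF trigger free(2)] push_letter_free[OF free'] by simp
  then have out: "stack_output ?\<sigma> ?\<pi> = 1 # 2 # Suc a # ?T"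
    by (simp add: stack_output_def)
  have "\<not> contains_231 (2 # Suc a # ?T)"
    using assms(4) contains_231_map_Suc[of "1 # a # \<tau>"] by (simp add: numeral_2_eq_2)
  moreover have "1 < t" if "subseq [c, t] (2 # Suc a # ?T)" for c t
    using subseq_pair_set[OF that] \<tau> a by auto
  ultimately have "\<not> contains_231 (1 # 2 # Suc a # ?T)"
    unfolding contains_231_Cons[of 1] by (meson less_asym)
  moreover have "\<not> contains_pattern [2, 3, 1] ?\<sigma>"
    using pattern_in_231[of a 1 \<tau>] assms(3) a by force
  moreover have "?\<pi> \<in> perms"
    using assms(1,2) a by (intro witness_in_perms[of a 1]) auto
  moreover have "contains_231 (rev ?\<pi>)"
    using witness_contains_231[OF a] by simp
  ultimately show ?thesis
    using not_class_witness[of ?\<pi> ?\<sigma>, unfolded out] by blast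
qed

text \<open>The permutation 1324 is unsortable, but it is contained in the sortable 361425 (as 1425); this
  is a pair of smallest size.\<close>

lemma not_class_231: "\<not> permutation_class (Sort [2, 3, 1])"
proof -
  define straddles :: "nat list \<Rightarrow> nat \<Rightarrow> bool"
    where "straddles w x \<longleftrightarrow> (\<exists>c a. subseq [c, a] w \<and> a < x \<and> x < c)" for w x
  have "straddles (y # w) x \<longleftrightarrow> straddles w x \<or> x < y \<and> (\<exists>a\<in>set w. a < x)" for x y w
    unfolding straddles_def subseq_pair_Cons by blast
  moreover have "\<not> straddles [] x" for x
    unfolding straddles_def by simp
  moreover have "contains_231 (x # w) \<longleftrightarrow> contains_231 w \<or> straddles w x" for x w
    unfolding straddles_def contains_231_Cons ..
  ultimately have eval: "contains_231 (x # w) \<longleftrightarrow> contains_231 w \<or> straddles w x"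
    "straddles (y # w) x \<longleftrightarrow> straddles w x \<or> x < y \<and> (\<exists>a\<in>set w. a < x)"
    "\<not> straddles [] x" for x y w
    by blast+
  have "stack_output [2, 3, 1] [3, 6, 1, 4, 2, 5] = [1, 6, 5, 2, 4, 3]"
    by (simp add: stack_output_def push_letter_def contains_pattern_231 eval del: One_nat_def)
  moreover have "\<not> contains_231 [1, 6, 5, 2, 4, 3]"
    by (simp add: eval del: One_nat_def)
  moreover have "[3, 6, 1, 4, 2, 5] \<in> perms"
    by (auto simp: perms_iff)
  ultimately have 1: "[3, 6, 1, 4, 2, 5] \<in> Sort [2, 3, 1]"
    by (simp only: Sort_def sortable_iff mem_Collect_eq simp_thms)
  have "stack_output [2, 3, 1] [1, 3, 2, 4] = [3, 4, 2, 1]"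
    by (simp add: stack_output_def push_letter_def contains_pattern_231 eval del: One_nat_def)
  moreover have "contains_231 [3, 4, 2, 1]"
    by (simp add: eval del: One_nat_def)
  moreover have 2: "[1, 3, 2, 4] \<in> perms"
    by (auto simp: perms_iff)
  ultimately have 3: "[1, 3, 2, 4] \<notin> Sort [2, 3, 1]"
    by (simp only: Sort_def sortable_iff mem_Collect_eq simp_thms)
  have "order_isomorphic [1, 4, 2, 5] [1, 3, 2, 4]" "subseq [1, 4, 2, 5] [3, 6, 1, 4, 2, 5 :: nat]"
    by simp_all
  then have "contains_pattern [3, 6, 1, 4, 2, 5] [1, 3, 2, 4]"
    unfolding contains_pattern_def by blast
  then show ?thesis
    using 1 2 3 unfolding permutation_class_def by blast
qed

text \<open>The reversal of the pattern is fed to the stack: its last letter forces a single pop, and the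
  output is the swap.\<close>

lemma not_class_if_contains_231:
  assumes "distinct (a # b # \<tau>)" "set (a # b # \<tau>) = {1..n}"
    and "a < b" "1 \<in> set \<tau>" "\<not> contains_231 (b # a # \<tau>)"
  shows "\<not> permutation_class (Sort (a # b # \<tau>))"
proof (cases "contains_pattern [2, 3, 1] (a # b # \<tau>)")
  case True
  moreover have "\<tau> \<noteq> []" using assms(4) by auto
  ultimately obtain t where t: "\<tau> = [t]" "t < a" "a < b"
    using pattern_in_231 by blast
  then have "t = 1" using assms(4) by simp
  have "n = 3"
    using distinct_card[OF assms(1)] unfolding assms(2) by (simp add: t(1))
  then have "a \<in> {1..3}" "b \<in> {1..3}"
    using assms(2) by auto
  then have "a # b # \<tau> = [2, 3, 1]"
    using t \<open>t = 1\<close> by auto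
  then show ?thesis using not_class_231 by simp
next
  case False
  let ?\<sigma> = "a # b # \<tau>"
  have "\<not> contains_pattern (b # \<tau>) ?\<sigma>" and free: "\<not> contains_pattern (a # \<tau>) ?\<sigma>"
    by (auto dest: contains_pattern_length)
  then have "fold (push_letter ?\<sigma>) (rev (b # \<tau>)) ([], []) = (b # \<tau>, [])"
    using fold_push_letter_free[of "rev (b # \<tau>)" "[]" ?\<sigma> "[]"] by simp
  then have out: "stack_output ?\<sigma> (rev ?\<sigma>) = b # a # \<tau>"
    using push_letter_pop_one[OF order_isomorphic_imp_contains[OF order_isomorphic_refl] free]
    by (simp add: stack_output_def)
  have "1 \<noteq> a" "1 \<le> a"
    using assms(1,2,4) by auto
  then have "contains_231 ?\<sigma>"
    using assms(3,4) unfolding contains_231_def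
    by (intro exI[of _ a] exI[of _ b] exI[of _ 1]) (auto simp: subseq_singleton_left)
  moreover have "rev ?\<sigma> \<in> perms"
    unfolding perms_def perms_of_length_iff UN_iff set_rev distinct_rev using assms(1,2) by blast
  ultimately show ?thesis
    using False assms(5) not_class_witness[of "rev ?\<sigma>" ?\<sigma>, unfolded out rev_rev_ident] by blast
qed

lemma class_iff_swap_contains_231:
  assumes "a # b # \<tau> \<in> perms_of_length n" "n \<ge> 3"
  shows "permutation_class (Sort (a # b # \<tau>)) \<longleftrightarrow> contains_231 (b # a # \<tau>)"
proof
  assume cls: "permutation_class (Sort (a # b # \<tau>))"
  have perm: "distinct (a # b # \<tau>)" "set (a # b # \<tau>) = {1..n}"
    using assms(1) by (simp_all add: perms_of_length_iff)
  have "\<tau> \<noteq> []"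
    using length_perms_of_length[OF assms(1)] assms(2) by auto
  show "contains_231 (b # a # \<tau>)"
  proof (rule ccontr)
    assume no: "\<not> contains_231 (b # a # \<tau>)"
    have "1 \<in> set (a # b # \<tau>)"
      using assms(2) unfolding perm(2) by simp
    then consider "a = 1" | "b = 1" | "a < b" "1 \<in> set \<tau>" | "b < a" "1 \<in> set \<tau>" "b \<noteq> 1"
      using perm(1) by fastforce
    then show False
    proof cases
      case 4
      have "1 \<le> b" using perm(2) by auto
      then have "contains_231 (b # a # \<tau>)"
        using 4 unfolding contains_231_def
        by (intro exI[of _ b] exI[of _ a] exI[of _ 1]) (auto simp: subseq_singleton_left)
      with no show False by simp
    qed (use not_class_if_starts_with_1 not_class_if_second_is_1 not_class_if_contains_231
        perm \<open>\<tau> \<noteq> []\<close> no cls in blast)+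
  qed
qed (rule class_if_swap_contains_231)

section \<open>Counting the permutations that avoid 231\<close>

definition catalan :: "nat \<Rightarrow> real" where
  "catalan n = 1 / (real n + 1) * real ((2 * n) choose n)"

lemma catalan_0: "catalan 0 = 1"
  by (simp add: catalan_def)

lemma catalan_Suc: "(real n + 2) * catalan (Suc n) = 2 * (2 * real n + 1) * catalan n"
proof -
  have 1: "real (Suc n) * real (Suc (Suc (2 * n)) choose Suc n) =
      real (Suc (Suc (2 * n))) * real (Suc (2 * n) choose n)"
    unfolding of_nat_mult[symmetric] by (simp only: Suc_times_binomial_eq mult.commute)
  have 2: "real (Suc n) * real (Suc (2 * n) choose n) = real (Suc (2 * n)) * real (2 * n choose n)"
    unfolding of_nat_mult[symmetric]
    using Suc_times_binomial_eq[of "2 * n" n] binomial_symmetric[of n "Suc (2 * n)"]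
    by (simp add: mult_ac)
  define x y z where "x = real (Suc (Suc (2 * n)) choose Suc n)"
    and "y = real (Suc (2 * n) choose n)" and "z = real (2 * n choose n)"
  have "(real n + 1) * x = 2 * ((real n + 1) * y)" "(real n + 1) * y = (2 * real n + 1) * z"
    using 1 2 unfolding x_def[symmetric] y_def[symmetric] z_def[symmetric]
    by (simp_all add: algebra_simps)
  then have "x = 2 * (2 * real n + 1) * (z / (real n + 1))"
    by (simp add: field_simps)
  moreover have "catalan (Suc n) = x / (real n + 2)" "catalan n = z / (real n + 1)"
    by (simp_all add: catalan_def x_def z_def add.commute del: binomial_Suc_Suc)
  ultimately show ?thesis
    by simp
qed

text \<open>Up to an index shift and the factor \<open>2 * (- 4) ^ n\<close>, Catalan numbers are the coefficients of the power series
  of the square root of \<open>1 + x\<close>. Their convolution is thus governed by Vandermonde's identity for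
  the exponents 1/2 and 1/2, which sum to 1.\<close>

lemma catalan_gbinomial: "catalan n = 2 * (- 4) ^ n * ((1 / 2) gchoose Suc n)"
proof (induction n)
  case 0
  then show ?case by (simp add: catalan_0)
next
  case (Suc n)
  define g where "g k = (1 / 2 gchoose k :: real)" for k
  have key: "(real n + 2) * g (Suc (Suc n)) = (1 / 2 - (real n + 1)) * g (Suc n)"
    using gbinomial_mult_1[of "1 / 2 :: real" "Suc n"] by (simp add: algebra_simps g_def)
  have "(real n + 2) * (2 * (- 4) ^ Suc n * g (Suc (Suc n))) =
      2 * (- 4) ^ Suc n * ((real n + 2) * g (Suc (Suc n)))"
    by simp
  also have "\<dots> = 2 * (- 4) ^ Suc n * ((1 / 2 - (real n + 1)) * g (Suc n))"
    unfolding key ..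
  also have "\<dots> = (real n + 2) * catalan (Suc n)"
    unfolding catalan_Suc Suc g_def[symmetric] by (simp add: algebra_simps)
  finally show ?case
    by (subst (asm) mult_left_cancel) (simp_all add: g_def)
qed

lemma catalan_convolution: "catalan (Suc n) = (\<Sum>i\<le>n. catalan i * catalan (n - i))"
proof -
  define h where "h k = (1 / 2 gchoose k :: real)" for k
  \<comment> \<open>The series squares to \<open>1 + x\<close>, so its coefficients from degree two on vanish.\<close>
  have "0 = (\<Sum>k\<le>Suc (Suc n). h k * h (Suc (Suc n) - k))"
    using gbinomial_Vandermonde[of "1 / 2 :: real" "1 / 2" "Suc (Suc n)"] binomial_gbinomial[of 1 "Suc (Suc n)", where 'a = real]
    by (simp add: h_def atMost_atLeast0)
  also have "\<dots> = 2 * h (Suc (Suc n)) + (\<Sum>i\<le>n. h (Suc i) * h (Suc (n - i)))"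
    by (subst sum.atMost_Suc, subst sum.atMost_Suc_shift)
      (auto simp: h_def Suc_diff_le intro!: sum.cong)
  finally have sum: "(\<Sum>i\<le>n. h (Suc i) * h (Suc (n - i))) = - 2 * h (Suc (Suc n))"
    by simp
  have "(\<Sum>i\<le>n. catalan i * catalan (n - i)) =
      (\<Sum>i\<le>n. 4 * (- 4) ^ n * (h (Suc i) * h (Suc (n - i))))"
    by (intro sum.cong refl) (simp add: catalan_gbinomial h_def mult_ac flip: power_add)
  also have "\<dots> = catalan (Suc n)"
    unfolding sum_distrib_left[symmetric] sum by (simp add: catalan_gbinomial h_def)
  finally show ?thesis ..
qed

text \<open>Intervals with arbitrary left end make this family closed under cutting a word at its
  maximum, so no standardisation of the two parts is needed.\<close>

definition avoiders :: "nat \<Rightarrow> nat \<Rightarrow> nat list set" where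
  "avoiders m n = {w. distinct w \<and> set w = {m..<m + n} \<and> \<not> contains_231 w}"

lemma finite_avoiders: "finite (avoiders m n)"
  by (rule finite_subset[OF _ finite_permutations_of_set[of "{m..<m + n}"]])
    (auto simp: avoiders_def permutations_of_set_def)

lemma length_avoiders:
  assumes "w \<in> avoiders m n"
  shows "length w = n"
proof -
  have "distinct w" "set w = {m..<m + n}"
    using assms by (simp_all add: avoiders_def)
  then show ?thesis
    using distinct_card[of w] by simp
qed

text \<open>The maximum can only play the role of 3, and any pair \<open>b\<close>, \<open>a\<close> with \<open>a < b\<close> on its two
  sides completes it to a 231.\<close>

lemma contains_231_split_at_max:
  assumes "\<forall>z\<in>set u \<union> set v. z < M"
  shows "contains_231 (u @ M # v) \<longleftrightarrow>
    contains_231 u \<or> contains_231 v \<or> (\<exists>b\<in>set u. \<exists>a\<in>set v. a < b)"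
  using assms
proof (induction u)
  case Nil
  then show ?case
    by (fastforce simp: contains_231_Cons dest: subseq_pair_set)
next
  case (Cons x u)
  have M: "x < M" "\<forall>z\<in>set u. z < M" "\<forall>z\<in>set v. z < M"
    using Cons.prems by auto
  have "(\<exists>c a. subseq [c, a] (u @ M # v) \<and> a < x \<and> x < c) \<longleftrightarrow>
      (\<exists>c a. subseq [c, a] u \<and> a < x \<and> x < c) \<or> (\<exists>a\<in>set v. a < x)"
    (is "?L \<longleftrightarrow> ?R")
  proof
    assume ?L
    then obtain c a where ca: "subseq [c, a] (u @ M # v)" "a < x" "x < c" by blast
    then have "a \<noteq> M" using M by simp
    then have "subseq [c, a] u \<or> a \<in> set v"
      using ca(1) subseq_pair_set[of c a v] unfolding subseq_pair_append subseq_pair_Cons by auto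
    then show ?R using ca by blast
  next
    show "?R \<Longrightarrow> ?L"
      using M unfolding subseq_pair_append subseq_pair_Cons by blast
  qed
  then show ?case
    using Cons.IH M by (simp add: contains_231_Cons[of x]) blast
qed

lemma initial_segment_split:
  fixes A B :: "nat set"
  assumes "A \<union> B = {m..<m + n}" "\<forall>x\<in>A. \<forall>y\<in>B. x < y"
  shows "A = {m..<m + card A}" "B = {m + card A..<m + n}"
proof -
  have "A = {m..<m + card A} \<and> B = {m + card A..<m + n}"
  proof (cases "B = {}")
    case True
    then show ?thesis using assms by simp
  next
    case False
    have "finite (A \<union> B)"
      unfolding assms(1) by simp
    then have fin: "finite B" by simp
    define b where "b = Min B"
    have b: "b \<in> B" "\<forall>y\<in>B. b \<le> y"
      using fin False by (auto simp: b_def)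
    have mem: "x \<in> A \<or> x \<in> B \<longleftrightarrow> m \<le> x \<and> x < m + n" for x
      using assms(1) by (auto simp: set_eq_iff)
    have A: "A = {m..<b}"
      using b assms(2) mem by (auto simp: set_eq_iff) (meson leD less_trans)+
    moreover have "m \<le> b"
      using b mem by blast
    moreover have "B = {b..<m + n}"
      using b assms(2) mem by (auto simp: set_eq_iff) (metis leD le_trans)
    ultimately show ?thesis by simp
  qed
  then show "A = {m..<m + card A}" "B = {m + card A..<m + n}" by blast+
qed

text \<open>Avoiding 231 forces the letters before the maximum to be smaller than those after it, so both
  sides are again intervals, determined by the length of the first part.\<close>

lemma avoiders_Suc:
  "avoiders m (Suc n) =
    (\<lambda>(u, v). u @ (m + n) # v) ` (\<Union>i\<le>n. avoiders m i \<times> avoiders (m + i) (n - i))"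
proof (intro equalityI subsetI)
  fix w assume w: "w \<in> avoiders m (Suc n)"
  then have "m + n \<in> set w" by (auto simp: avoiders_def)
  then obtain u v where uv: "w = u @ (m + n) # v" by (auto simp: in_set_conv_decomp)
  have d: "distinct u" "distinct v" "set u \<inter> set v = {}" "m + n \<notin> set u \<union> set v"
    using w by (auto simp: avoiders_def uv)
  have "insert (m + n) (set u \<union> set v) = {m..<m + Suc n}"
    using w by (simp add: avoiders_def uv)
  moreover have "{m..<m + Suc n} = insert (m + n) {m..<m + n}"
    by auto
  ultimately have un: "set u \<union> set v = {m..<m + n}"
    using d(4) by (metis atLeastLessThan_iff insert_ident less_irrefl)
  then have "\<forall>z\<in>set u \<union> set v. z < m + n" by simp
  then have no: "\<not> contains_231 u" "\<not> contains_231 v" "\<forall>b\<in>set u. \<forall>a\<in>set v. b \<le> a"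
    using w contains_231_split_at_max[of u v "m + n"] by (force simp: avoiders_def uv)+
  then have less: "\<forall>b\<in>set u. \<forall>a\<in>set v. b < a"
    using d(3) by (metis disjoint_iff le_neq_implies_less)
  note split = initial_segment_split[OF un less, unfolded distinct_card[OF d(1)]]
  have "length u + length v = card (set u \<union> set v)"
    using d by (simp add: card_Un_disjoint distinct_card)
  then have "length u \<le> n"
    unfolding un by simp
  moreover have "u \<in> avoiders m (length u)" "v \<in> avoiders (m + length u) (n - length u)"
    using split d no \<open>length u \<le> n\<close> by (auto simp: avoiders_def)
  ultimately show "w \<in> (\<lambda>(u, v). u @ (m + n) # v) `
      (\<Union>i\<le>n. avoiders m i \<times> avoiders (m + i) (n - i))"
    unfolding uv by (intro image_eqI[of _ _ "(u, v)"]) auto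
next
  fix w assume "w \<in> (\<lambda>(u, v). u @ (m + n) # v) `
      (\<Union>i\<le>n. avoiders m i \<times> avoiders (m + i) (n - i))"
  then obtain i u v where w: "i \<le> n" "u \<in> avoiders m i" "v \<in> avoiders (m + i) (n - i)"
    "w = u @ (m + n) # v"
    by auto
  then have s: "set u = {m..<m + i}" "set v = {m + i..<m + n}"
    by (simp_all add: avoiders_def)
  have "\<not> contains_231 w"
    using w s contains_231_split_at_max[of u v "m + n"] by (force simp: avoiders_def)
  moreover have "distinct w" "set w = {m..<m + Suc n}"
    using w s by (auto simp: avoiders_def)
  ultimately show "w \<in> avoiders m (Suc n)"
    by (simp add: avoiders_def)
qed

lemma card_avoiders: "real (card (avoiders m n)) = catalan n"
proof (induction n arbitrary: m rule: less_induct)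
  case (less n)
  show ?case
  proof (cases n)
    case 0
    then have "avoiders m n = {[]}" by (auto simp: avoiders_def)
    then show ?thesis using 0 by (simp add: catalan_0)
  next
    case (Suc k)
    let ?P = "\<lambda>i. avoiders m i \<times> avoiders (m + i) (k - i)"
    have "inj_on (\<lambda>(u, v). u @ (m + k) # v) (\<Union>i\<le>k. ?P i)"
      by (auto simp: inj_on_def avoiders_def append_Cons_eq_iff)
    then have "card (avoiders m n) = card (\<Union>i\<le>k. ?P i)"
      unfolding Suc avoiders_Suc by (rule card_image)
    also have "\<dots> = (\<Sum>i\<le>k. card (?P i))"
    proof (rule card_UN_disjoint)
      show "\<forall>i\<in>{..k}. \<forall>j\<in>{..k}. i \<noteq> j \<longrightarrow> ?P i \<inter> ?P j = {}"
        using length_avoiders by blast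
    qed (auto simp: finite_avoiders)
    finally have "real (card (avoiders m n)) = (\<Sum>i\<le>k. catalan i * catalan (k - i))"
      by (simp add: card_cartesian_product less.IH Suc)
    then show ?thesis
      by (simp add: Suc catalan_convolution)
  qed
qed

fun swap_first_two :: "'a list \<Rightarrow> 'a list" where
  "swap_first_two (a # b # w) = b # a # w"
| "swap_first_two w = w"

lemma swap_first_two_swap_first_two [simp]: "swap_first_two (swap_first_two w) = w"
  by (cases w rule: swap_first_two.cases) auto

lemma swap_first_two_in_perms:
  "w \<in> perms_of_length n \<Longrightarrow> swap_first_two w \<in> perms_of_length n"
  by (cases w rule: swap_first_two.cases) (auto simp: perms_of_length_iff)

theorem corollary3p10:
  fixes n :: nat
  assumes "n \<ge> 3"
  shows "real (card {\<sigma> \<in> perms_of_length n. \<not> permutation_class (Sort \<sigma>)})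
           = 1 / (real n + 1) * real ((2 * n) choose n)"
proof -
  let ?N = "{\<sigma> \<in> perms_of_length n. \<not> permutation_class (Sort \<sigma>)}"
  have "{1..<1 + n} = {1..n}"
    by auto
  then have avoiders: "avoiders 1 n = {w \<in> perms_of_length n. \<not> contains_231 w}"
    unfolding avoiders_def perms_of_length_iff by simp
  have iff: "permutation_class (Sort \<sigma>) \<longleftrightarrow> contains_231 (swap_first_two \<sigma>)"
    if \<sigma>: "\<sigma> \<in> perms_of_length n" for \<sigma>
  proof -
    have "length \<sigma> \<ge> 2"
      using length_perms_of_length[OF \<sigma>] assms by simp
    then obtain a b \<tau> where "\<sigma> = a # b # \<tau>"
      by (cases \<sigma> rule: swap_first_two.cases) auto
    then show ?thesis
      using class_iff_swap_contains_231[of a b \<tau> n] \<sigma> assms by simp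
  qed
  have "bij_betw swap_first_two ?N (avoiders 1 n)"
    unfolding avoiders
    by (rule bij_betw_byWitness[of _ swap_first_two]) (auto simp: iff swap_first_two_in_perms)
  then have "card ?N = card (avoiders 1 n)"
    by (rule bij_betw_same_card)
  then show ?thesis
    using card_avoiders[of 1 n] by (simp add: catalan_def)
qed

end
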